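(* Let $s\in(0,1)$ and let $\Omega\subset\mathbb{R}^n$ be a domain with $C^1$ boundary. Let $u:\mathbb{R}^n\to\mathbb{R}$ be continuous in $\overline{\Omega}$ (i.e. the restriction of $u$ to $\overline\Omega$ is continuous), with $\mathcal{N}_su=0$ in $\mathbb{R}^n\setminus\overline{\Omega}$. Then $u$ is continuous in the whole of $\mathbb{R}^n$.
   Context: $\mathcal{N}_su(x)=c_{n,s}\int_\Omega\frac{u(x)-u(y)}{|x-y|^{n+2s}}\,dy$ for $x\in\mathbb{R}^n\setminus\overline{\Omega}$, where $c_{n,s}>0$ is a constant depending only on $n$ and $s$. The condition $\mathcal{N}_su(x)=0$ includes that the integral is (absolutely) convergent, and is equivalent to $$u(x)=\frac{\int_\Omega\frac{u(y)}{|x-y|^{n+2s}}\,dy}{\int_\Omega\frac{dy}{|x-y|^{n+2s}}}.$$ *)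

theory Defs
  imports "HOL-Analysis.Analysis"
begin

definition C1_function :: "('a::real_normed_vector \<Rightarrow> 'b::real_normed_vector) \<Rightarrow> bool" where
  "C1_function g \<longleftrightarrow>
    (\<exists>g' :: 'a \<Rightarrow> 'a \<Rightarrow>\<^sub>L 'b.
      (\<forall>x. (g has_derivative blinfun_apply (g' x)) (at x)) \<and> continuous_on UNIV g')"

text \<open>
  Near each boundary point, the set is the strict epigraph of a \<open>C\<^sup>1\<close> function of \<open>n - 1\<close>
  variables in suitably rotated coordinates.  The rotation is encoded by the unit vector \<open>e\<close>
  giving the direction of the last coordinate axis: \<open>x \<bullet> e\<close> is the last coordinate and
  \<open>x - (x \<bullet> e) *\<^sub>R e\<close> stands for the remaining ones.  Only the restriction of \<open>g\<close> to the
  hyperplane orthogonal to \<open>e\<close> matters; since every \<open>C\<^sup>1\<close> function on that hyperplane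
  extends to the whole space through the orthogonal projection, taking \<open>g\<close> on the whole space is
  no restriction.  In dimension 1 the hyperplane is a point, and the set is locally a half-line.
\<close>

definition has_C1_boundary :: "('a::euclidean_space) set \<Rightarrow> bool" where
  "has_C1_boundary \<Omega> \<longleftrightarrow>
    (\<forall>x0 \<in> frontier \<Omega>. \<exists>r e (g :: 'a \<Rightarrow> real).
      0 < r \<and> norm e = 1 \<and> C1_function g \<and>
      \<Omega> \<inter> ball x0 r = {x \<in> ball x0 r. x \<bullet> e > g (x - (x \<bullet> e) *\<^sub>R e)})"

definition neumann_integrand ::
    "real \<Rightarrow> (real^'n \<Rightarrow> real) \<Rightarrow> real^'n \<Rightarrow> real^'n \<Rightarrow> real" where
  "neumann_integrand s u x y = (u x - u y) / norm (x - y) powr (real CARD('n) + 2 * s)"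

text \<open>
  The parameter \<open>c\<close> is the positive normalising constant, which may depend on the dimension and
  on \<open>s\<close>.  The value is junk (zero) where the integral does not converge absolutely.
\<close>

definition neumann_op ::
    "real \<Rightarrow> real \<Rightarrow> (real^'n) set \<Rightarrow> (real^'n \<Rightarrow> real) \<Rightarrow> real^'n \<Rightarrow> real" where
  "neumann_op c s \<Omega> u x = c * set_lebesgue_integral lebesgue \<Omega> (neumann_integrand s u x)"

text \<open>Vanishing at a point includes absolute convergence of the defining integral there.\<close>

definition neumann_op_vanishes ::
    "real \<Rightarrow> real \<Rightarrow> (real^'n) set \<Rightarrow> (real^'n \<Rightarrow> real) \<Rightarrow> real^'n \<Rightarrow> bool" where
  "neumann_op_vanishes c s \<Omega> u x \<longleftrightarrow>
    neumann_integrand s u x absolutely_integrable_on \<Omega> \<and> neumann_op c s \<Omega> u x = 0"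

end

theory Submission
  imports Defs
begin

text \<open>
  Write \<open>K x y = |x - y| powr -(n + 2s)\<close>. Outside \<open>closure \<Omega>\<close>, \<open>u x\<close> is the average of \<open>u\<close> over \<open>\<Omega>\<close> with weight
  \<open>K x\<close>, and dominated convergence gives continuity there. At a boundary point \<open>x0\<close>, the
  \<open>C\<^sup>1\<close> condition puts a ball of radius comparable to \<open>|x - x0|\<close> inside \<open>\<Omega>\<close> at distance
  comparable to \<open>|x - x0|\<close> from \<open>x\<close>, so the total weight is at least a multiple of
  \<open>|x - x0| powr -2s\<close> and blows up. The part of the weight away from \<open>x0\<close> stays bounded, even
  when multiplied by \<open>|u - u x0|\<close>: it is dominated by \<open>K x1\<close> for any fixed exterior point \<open>x1\<close>.
  Hence the average concentrates at \<open>x0\<close>.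
\<close>

section \<open>Integrability and comparison of the kernels
  \<open>norm (x - y) powr - a\<close>\<close>

lemma riesz_kernel_integrable_off_ball:
  fixes x :: "'a::euclidean_space"
  assumes a: "real DIM('a) < a" and d: "0 < \<delta>"
  shows "(\<lambda>y. norm (x - y) powr - a) absolutely_integrable_on (- ball x \<delta>)"
proof -
  let ?f = "\<lambda>y. indicator (- ball x \<delta>) y * norm (x - y) powr - a"
  let ?n = "DIM('a)"
  define V where "V = unit_ball_vol (real ?n)"
  \<comment> \<open>\<open>C * q ^ k\<close> is the bound \<open>(2 ^ k * \<delta>) powr - a\<close>
    for the kernel times the volume of the ball of radius \<open>2 ^ Suc k * \<delta>\<close>;
    \<open>q < 1\<close> because \<open>a\<close> exceeds the dimension.\<close>
  define q :: real where "q = 2 powr (real ?n - a)"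
  define C where "C = \<delta> powr - a * (V * (2 * \<delta>) ^ ?n)"
  have V0: "0 \<le> V" by (simp add: V_def)
  have q: "0 < q" "q < 1" using a by (auto simp: q_def powr_less_one)
  have meas: "?f \<in> borel_measurable borel" by measurable
  \<comment> \<open>The kernel is dominated by a sum over the dyadic balls around \<open>x\<close> whose integrals form a
    geometric series.\<close>
  have shell: "(2 ^ k * \<delta>) powr - a * (V * (2 ^ Suc k * \<delta>) ^ ?n) = C * q ^ k" for k
  proof -
    have "q ^ k = 2 powr (real ?n * real k) * 2 powr (- a * real k)"
      by (simp add: q_def powr_power powr_add [symmetric] algebra_simps)
    moreover have "2 powr (real ?n * real k) = ((2::real) ^ k) ^ ?n"
      by (simp add: powr_realpow powr_powr power_mult [symmetric] mult.commute flip: of_nat_mult)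
    moreover have "(2 ^ k * \<delta>) powr - a = 2 powr (- a * real k) * \<delta> powr - a"
      using d by (simp add: powr_mult powr_realpow [symmetric] powr_powr mult.commute)
    ultimately show ?thesis
      by (simp add: C_def power_mult_distrib algebra_simps)
  qed
  have bound: "ennreal (?f y) \<le>
      (\<Sum>k. ennreal ((2 ^ k * \<delta>) powr - a) * indicator (ball x (2 ^ Suc k * \<delta>)) y)" (is "_ \<le> suminf ?t")
    for y
  proof (cases "y \<in> ball x \<delta>")
    case False
    \<comment> \<open>The dyadic shell containing \<open>y\<close>. Minimality gives its inner
      radius \<open>2 ^ k * \<delta>\<close>; for \<open>k = 0\<close> that bound comes from
      \<open>y\<close> lying outside \<open>ball x \<delta>\<close>.\<close>
    define k where "k = (LEAST k. norm (x - y) < 2 ^ Suc k * \<delta>)"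
    obtain m where "norm (x - y) / \<delta> < 2 ^ m"
      using real_arch_pow [of 2 "norm (x - y) / \<delta>"] by auto
    also have "\<dots> \<le> 2 ^ Suc m" by simp
    finally have "norm (x - y) < 2 ^ Suc m * \<delta>" using d by (simp add: field_simps)
    then have k: "norm (x - y) < 2 ^ Suc k * \<delta>" unfolding k_def by (rule LeastI)
    have "2 ^ k * \<delta> \<le> norm (x - y)"
    proof (cases k)
      case 0
      then show ?thesis using False by (simp add: dist_norm)
    next
      case (Suc j)
      then have "\<not> norm (x - y) < 2 ^ Suc j * \<delta>"
        unfolding k_def by (metis lessI not_less_Least)
      then show ?thesis using Suc by simp
    qed
    then have "norm (x - y) powr - a \<le> (2 ^ k * \<delta>) powr - a"
      using a d by (intro powr_mono2') auto
    then have "ennreal (?f y) \<le> ?t k"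
      using False k by (auto simp: dist_norm indicator_def intro!: ennreal_leI)
    also have "?t k \<le> suminf ?t"
    proof -
      have "h k \<le> suminf h" for h :: "nat \<Rightarrow> ennreal"
        using sum_le_suminf [of h "{k}"] by simp
      then show ?thesis .
    qed
    finally show ?thesis .
  qed auto
  define h where "h = (\<lambda>k y. ennreal ((2 ^ k * \<delta>) powr - a) * indicator (ball x (2 ^ Suc k * \<delta>)) y)"
  have h: "h k \<in> borel_measurable lborel"
    "(\<integral>\<^sup>+y. h k y \<partial>lborel) = ennreal ((2 ^ k * \<delta>) powr - a) * emeasure lborel (ball x (2 ^ Suc k * \<delta>))" for k
    unfolding h_def by (intro borel_measurable_times_ennreal borel_measurable_const borel_measurable_indicator
        nn_integral_cmult_indicator; simp)+
  have "(\<integral>\<^sup>+y. ennreal (?f y) \<partial>lborel) \<le> (\<integral>\<^sup>+y. (\<Sum>k. h k y) \<partial>lborel)"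
    unfolding h_def by (intro nn_integral_mono bound)
  also have "\<dots> = (\<Sum>k. \<integral>\<^sup>+y. h k y \<partial>lborel)"
    by (rule nn_integral_suminf) (rule h)
  also have "\<dots> = (\<Sum>k. ennreal (C * q ^ k))"
  proof -
    have "(\<integral>\<^sup>+y. h k y \<partial>lborel) = ennreal (C * q ^ k)" for k
      using d V0 by (simp add: h emeasure_ball ennreal_mult [symmetric] V_def [symmetric] shell [symmetric] del: power_Suc)
    then show ?thesis by simp
  qed
  also have "\<dots> < \<infinity>"
  proof -
    have "summable (\<lambda>k. C * q ^ k)" using q by (intro summable_mult summable_geometric) auto
    moreover have "0 \<le> C * q ^ k" for k using V0 d q by (auto simp: C_def)
    ultimately have "(\<Sum>k. ennreal (C * q ^ k)) = ennreal (\<Sum>k. C * q ^ k)"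
      by (intro suminf_ennreal2)
    then show ?thesis by (simp only: infinity_ennreal_def ennreal_less_top)
  qed
  finally have "integrable lborel ?f"
    by (intro integrableI_bounded) (use meas in auto)
  then show ?thesis
    using meas by (simp add: set_integrable_def integrable_completion)
qed

lemma riesz_kernel_integrable:
  fixes x :: "'a::euclidean_space"
  assumes "real DIM('a) < a" "A \<in> sets lebesgue" "x \<notin> closure A"
  shows "(\<lambda>y. norm (x - y) powr - a) absolutely_integrable_on A"
proof -
  obtain \<delta> where "0 < \<delta>" "ball x \<delta> \<subseteq> - closure A"
    using assms(3) open_contains_ball [of "- closure A"] by auto
  moreover have "A \<subseteq> closure A" by (rule closure_subset)
  ultimately show ?thesis
    using riesz_kernel_integrable_off_ball [OF assms(1)] assms(2)
    by (meson set_integrable_subset disjoint_eq_subset_Compl order_trans Compl_subset_Compl_iff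
        subset_Compl_self_eq compl_le_swap1)
qed

text \<open>For \<open>y\<close> far from \<open>x0\<close>, both distances compare with
  \<open>norm (x0 - y)\<close>: the one from \<open>x\<close> is at least half of it, the one from
  \<open>x1\<close> at most \<open>norm (x1 - x0) / \<delta> + 1\<close> times it. The constant is
  uniform in \<open>x\<close>, as domination requires.\<close>

lemma riesz_kernel_le_far:
  fixes x x0 x1 y :: "'a::real_normed_vector"
  assumes a: "0 \<le> a" and d: "0 < \<delta>" and far: "\<delta> \<le> norm (x0 - y)" and near: "norm (x - x0) \<le> \<delta> / 2"
    and ne: "x1 \<noteq> y"
  shows "norm (x - y) powr - a \<le> (2 * (norm (x1 - x0) / \<delta> + 1)) powr a * norm (x1 - y) powr - a"
proof -
  define M where "M = 2 * (norm (x1 - x0) / \<delta> + 1)"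
  have M: "0 < M" using d by (simp add: M_def add_nonneg_pos)
  have "norm (x0 - y) \<le> norm (x - x0) + norm (x - y)"
    using norm_triangle_ineq [of "x0 - x" "x - y"] by (simp add: norm_minus_commute)
  then have h: "norm (x0 - y) \<le> 2 * norm (x - y)" using far near by simp
  have "norm (x1 - y) \<le> norm (x1 - x0) + norm (x0 - y)"
    using norm_triangle_ineq [of "x1 - x0" "x0 - y"] by simp
  also have "norm (x1 - x0) = (norm (x1 - x0) / \<delta>) * \<delta>" using d by simp
  also have "\<dots> \<le> (norm (x1 - x0) / \<delta>) * norm (x0 - y)"
    using far d by (intro mult_left_mono) auto
  also have "(norm (x1 - x0) / \<delta>) * norm (x0 - y) + norm (x0 - y) = (norm (x1 - x0) / \<delta> + 1) * norm (x0 - y)"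
    by (simp add: algebra_simps)
  also have "\<dots> \<le> (norm (x1 - x0) / \<delta> + 1) * (2 * norm (x - y))"
    using h d by (intro mult_left_mono) auto
  finally have "norm (x1 - y) / M \<le> norm (x - y)" using M by (simp add: M_def field_simps)
  \<comment> \<open>\<open>ne\<close> keeps the smaller base positive: \<open>0 powr - a\<close> is
    0, which would break monotonicity.\<close>
  then have "norm (x - y) powr - a \<le> (norm (x1 - y) / M) powr - a"
    using a M ne by (intro powr_mono2') auto
  also have "\<dots> = M powr a * norm (x1 - y) powr - a"
    using M by (simp add: powr_divide powr_minus field_simps)
  finally show ?thesis by (simp add: M_def)
qed

text \<open>Dominated convergence: the comparison above with \<open>x1 = x0\<close> bounds all
  integrands for \<open>x\<close> within \<open>\<delta> / 2\<close> of \<open>x0\<close> by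
  \<open>2 powr a\<close> times the one at \<open>x0\<close>. The weight \<open>f\<close> serves
  both numerator (\<open>f = u\<close>) and denominator (\<open>f = 1\<close>) of the
  average.\<close>

lemma riesz_potential_continuous_off_closure:
  fixes f :: "'a::euclidean_space \<Rightarrow> real"
  assumes a: "0 \<le> a" and x0: "x0 \<notin> closure A"
    and int: "\<And>x. x \<notin> closure A \<Longrightarrow> (\<lambda>y. f y * norm (x - y) powr - a) absolutely_integrable_on A"
  shows "isCont (\<lambda>x. LINT y:A|lebesgue. f y * norm (x - y) powr - a) x0"
proof -
  obtain \<delta> where d: "0 < \<delta>" and ball: "ball x0 \<delta> \<subseteq> - closure A"
    using x0 open_contains_ball [of "- closure A"] by auto
  have far: "\<delta> \<le> norm (x0 - y)" if "y \<in> A" for y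
    using ball that closure_subset [of A] by (force simp: dist_norm)
  let ?F = "\<lambda>x y. indicator A y *\<^sub>R (f y * norm (x - y) powr - a)"
  have "(\<lambda>i. LINT y|lebesgue. ?F (X i) y) \<longlonglongrightarrow> (LINT y|lebesgue. ?F x0 y)"
    if X: "X \<longlonglongrightarrow> x0" "\<And>i. X i \<in> ball x0 (\<delta> / 2)" for X
  proof (rule integral_dominated_convergence [where w = "\<lambda>y. 2 powr a * \<bar>?F x0 y\<bar>"])
    show "?F x0 \<in> borel_measurable lebesgue"
      using int [OF x0] by (auto simp: set_integrable_def)
    have "X i \<notin> closure A" for i using X(2) [of i] ball d by (force simp: subset_iff)
    then show "?F (X i) \<in> borel_measurable lebesgue" for i
      using int by (auto simp: set_integrable_def)
    show "integrable lebesgue (\<lambda>y. 2 powr a * \<bar>?F x0 y\<bar>)"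
      using int [OF x0] by (auto simp: set_integrable_def)
    show "AE y in lebesgue. (\<lambda>i. ?F (X i) y) \<longlonglongrightarrow> ?F x0 y"
    proof (rule AE_I2)
      fix y
      show "(\<lambda>i. ?F (X i) y) \<longlonglongrightarrow> ?F x0 y"
      proof (cases "y \<in> A")
        case True
        then have "norm (x0 - y) \<noteq> 0" using far d by force
        then show ?thesis using X(1) by (intro tendsto_intros) auto
      qed simp
    qed
    show "AE y in lebesgue. norm (?F (X i) y) \<le> 2 powr a * \<bar>?F x0 y\<bar>" for i
    proof (rule AE_I2)
      fix y
      show "norm (?F (X i) y) \<le> 2 powr a * \<bar>?F x0 y\<bar>"
      proof (cases "y \<in> A")
        case True
        have "norm (X i - y) powr - a \<le> 2 powr a * norm (x0 - y) powr - a"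
          using riesz_kernel_le_far [OF a d far [OF True], of "X i" x0] X(2) [of i] far [OF True] d
          by (force simp: dist_norm norm_minus_commute)
        then have "\<bar>f y\<bar> * norm (X i - y) powr - a \<le> \<bar>f y\<bar> * (2 powr a * norm (x0 - y) powr - a)"
          by (intro mult_left_mono) auto
        then show ?thesis using True by (simp add: abs_mult mult_ac)
      qed simp
    qed
  qed
  then have "continuous (at x0 within ball x0 (\<delta> / 2)) (\<lambda>x. LINT y|lebesgue. ?F x y)"
    by (auto simp: continuous_within_sequentially o_def)
  then show ?thesis
    using d by (simp add: at_within_open [of x0 "ball x0 (\<delta> / 2)"] set_lebesgue_integral_def)
qed

section \<open>Lower bounds for the total weight and its blow-up at the boundary\<close>

lemma riesz_potential_lower_bound:
  fixes x :: "'a::euclidean_space"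
  assumes int: "(\<lambda>y. norm (x - y) powr - a) absolutely_integrable_on A"
    and B: "ball z \<rho> \<subseteq> A" "0 \<le> \<rho>" "x \<notin> A" "0 \<le> a"
    and R: "\<And>y. y \<in> ball z \<rho> \<Longrightarrow> norm (x - y) \<le> R"
  shows "unit_ball_vol DIM('a) * \<rho> ^ DIM('a) * R powr - a \<le> (LINT y:A|lebesgue. norm (x - y) powr - a)"
proof -
  have "unit_ball_vol DIM('a) * \<rho> ^ DIM('a) * R powr - a
      = (LINT y|lebesgue. indicator (ball z \<rho>) y *\<^sub>R R powr - a)"
    using B by (simp add: content_ball)
  also have "\<dots> \<le> (LINT y|lebesgue. indicator A y *\<^sub>R norm (x - y) powr - a)"
  proof (rule integral_mono)
    show "integrable lebesgue (\<lambda>y. indicator (ball z \<rho>) y *\<^sub>R R powr - a)"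
      using B by (intro integrable_scaleR_left integrable_real_indicator) (auto simp: emeasure_ball)
    show "integrable lebesgue (\<lambda>y. indicator A y *\<^sub>R norm (x - y) powr - a)"
      using int by (simp add: set_integrable_def)
    fix y
    show "indicator (ball z \<rho>) y *\<^sub>R R powr - a \<le> indicator A y *\<^sub>R norm (x - y) powr - a"
    proof (cases "y \<in> ball z \<rho>")
      case True
      then have "0 < norm (x - y)" using B by auto
      then have "R powr - a \<le> norm (x - y) powr - a"
        using R [OF True] B by (intro powr_mono2') auto
      then show ?thesis using True B by auto
    qed auto
  qed
  finally show ?thesis by (simp add: set_lebesgue_integral_def)
qed

text \<open>Differentiability of \<open>g\<close> at the projection of \<open>x0\<close> bounds its
  growth from there linearly, so near \<open>x0\<close> the set contains a cone with vertex
  \<open>x0\<close> and axis \<open>e\<close>. A ball centred on the axis with radius a fixed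
  fraction of \<open>d\<close> fits into it.\<close>

lemma C1_boundary_interior_balls:
  fixes \<Omega> :: "'a::euclidean_space set"
  assumes "has_C1_boundary \<Omega>" "x0 \<in> frontier \<Omega>"
  obtains e :: 'a and \<eta> r where "norm e = 1" "0 < \<eta>" "\<eta> \<le> 1 / 2" "0 < r"
    "\<And>d. 0 < d \<Longrightarrow> d < r \<Longrightarrow> ball (x0 + (d / 2) *\<^sub>R e) (\<eta> * d) \<subseteq> \<Omega>"
proof -
  obtain r e and g :: "'a \<Rightarrow> real" where r: "0 < r" and e: "norm e = 1" and g: "C1_function g"
    and epi: "\<Omega> \<inter> ball x0 r = {x \<in> ball x0 r. x \<bullet> e > g (x - (x \<bullet> e) *\<^sub>R e)}"
    using bspec [OF assms(1) [unfolded has_C1_boundary_def] assms(2)] by blast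
  define P where "P = (\<lambda>x. x - (x \<bullet> e) *\<^sub>R e)"
  have epi': "x \<in> \<Omega> \<longleftrightarrow> x \<bullet> e > g (P x)" if "x \<in> ball x0 r" for x
  proof -
    have "x \<in> \<Omega> \<longleftrightarrow> x \<in> \<Omega> \<inter> ball x0 r" using that by blast
    then show ?thesis using that unfolding epi P_def by blast
  qed
  obtain g' where g': "\<And>x. (g has_derivative blinfun_apply (g' x)) (at x)"
    using g unfolding C1_function_def by blast
  have contg: "isCont g x" for x using g' has_derivative_continuous by blast
  have contP: "isCont (\<lambda>x. g (P x)) x0"
    unfolding P_def by (intro continuous_intros isCont_o2 [OF _ contg])
  \<comment> \<open>Otherwise a whole neighbourhood of \<open>x0\<close> lies strictly below the
    graph, although \<open>\<Omega>\<close> has points arbitrarily close to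
    \<open>x0\<close>.\<close>
  have base: "g (P x0) \<le> x0 \<bullet> e"
  proof (rule ccontr)
    assume neg: "\<not> ?thesis"
    then have "0 < g (P x0) - x0 \<bullet> e" by simp
    moreover have "((\<lambda>x. g (P x) - x \<bullet> e) \<longlongrightarrow> g (P x0) - x0 \<bullet> e) (at x0)"
      using contP by (intro tendsto_intros) (simp add: isCont_def)
    ultimately have "eventually (\<lambda>x. 0 < g (P x) - x \<bullet> e) (at x0)"
      by (rule order_tendstoD(1)[rotated])
    then obtain t where t: "0 < t" "\<And>x. x \<noteq> x0 \<Longrightarrow> dist x x0 < t \<Longrightarrow> x \<bullet> e < g (P x)"
      by (auto simp: eventually_at)
    have "x0 \<in> closure \<Omega>" using assms(2) by (auto simp: frontier_def)
    then obtain y where y: "y \<in> \<Omega>" "dist y x0 < min t r"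
      using r t(1) by (metis closure_approachable min_less_iff_conj)
    then have "y \<bullet> e > g (P y)" using epi' by (auto simp: dist_commute)
    moreover from this have "y \<noteq> x0" using neg by auto
    ultimately show False using t(2) [of y] y(2) by auto
  qed
  \<comment> \<open>The derivative at \<open>P x0\<close> with error tolerance 1, which accounts for
    the \<open>+ 1\<close> in the slope \<open>L\<close>.\<close>
  obtain t where t: "0 < t" and
    lin: "\<And>p. norm (p - P x0) < t \<Longrightarrow> norm (g p - g (P x0) - g' (P x0) (p - P x0)) \<le> 1 * norm (p - P x0)"
    using g' [of "P x0"] unfolding has_derivative_at_alt by (metis zero_less_one)
  define L where "L = norm (g' (P x0)) + 1"
  have L: "1 \<le> L" by (simp add: L_def)
  have lip: "g p \<le> g (P x0) + L * norm (p - P x0)" if "norm (p - P x0) < t" for p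
  proof -
    have "\<bar>g' (P x0) (p - P x0)\<bar> \<le> norm (g' (P x0)) * norm (p - P x0)"
      using norm_blinfun [of "g' (P x0)" "p - P x0"] by simp
    then show ?thesis using lin [OF that] by (simp add: L_def algebra_simps)
  qed
  \<comment> \<open>Moving by \<open>w\<close> off the point at height \<open>d / 2\<close> lowers
    the height by at most \<open>norm w\<close> and moves the projection by at most
    \<open>2 * norm w\<close>, so raises the bound on \<open>g\<close> by at most
    \<open>2 * L * norm w\<close>. Hence \<open>(1 + 2 * L) * \<eta> \<le> 1 / 2\<close>
    suffices.\<close>
  define \<eta> where "\<eta> = 1 / (4 * (1 + L))"
  have \<eta>: "0 < \<eta>" "\<eta> \<le> 1 / 2" "\<eta> + 2 * L * \<eta> \<le> 1 / 2"
    using L by (auto simp: \<eta>_def field_simps)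
  \<comment> \<open>\<open>d < r\<close> keeps the ball inside the chart, \<open>d < t\<close> keeps
    its projection where \<open>lip\<close> applies.\<close>
  show thesis
  proof (rule that [of e \<eta> "min r t"])
    fix d :: real
    assume d: "0 < d" "d < min r t"
    show "ball (x0 + (d / 2) *\<^sub>R e) (\<eta> * d) \<subseteq> \<Omega>"
    proof
      fix y assume "y \<in> ball (x0 + (d / 2) *\<^sub>R e) (\<eta> * d)"
      define w where "w = y - (x0 + (d / 2) *\<^sub>R e)"
      have y: "y = x0 + (d / 2) *\<^sub>R e + w" by (simp add: w_def)
      have w: "norm w < \<eta> * d"
        using \<open>y \<in> _\<close> by (simp add: w_def dist_norm norm_minus_commute)
      have \<eta>d: "\<eta> * d \<le> d / 2" using \<eta>(2) d(1) by (simp add: field_simps)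
      have "norm ((d / 2) *\<^sub>R e + w) \<le> d / 2 + norm w"
        using norm_triangle_ineq [of "(d / 2) *\<^sub>R e" w] e d by simp
      then have "norm (y - x0) < r" using w \<eta>d d unfolding y add_diff_cancel_left' add.assoc by linarith
      then have yr: "y \<in> ball x0 r" by (simp add: dist_norm norm_minus_commute)
      have ee: "e \<bullet> e = 1" using e by (simp add: norm_eq_1)
      have we: "\<bar>w \<bullet> e\<bar> \<le> norm w" using Cauchy_Schwarz_ineq2 [of w e] e by simp
      have Pd: "P y - P x0 = w - (w \<bullet> e) *\<^sub>R e"
        by (simp add: P_def y inner_add_left ee algebra_simps)
      have "norm (P y - P x0) \<le> norm w + \<bar>w \<bullet> e\<bar>"
        using norm_triangle_ineq4 [of w "(w \<bullet> e) *\<^sub>R e"] e by (simp add: Pd)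
      then have Pn: "norm (P y - P x0) \<le> 2 * norm w" using we by simp
      then have "norm (P y - P x0) < t" using w \<eta>d d by linarith
      then have "g (P y) \<le> g (P x0) + L * norm (P y - P x0)" by (rule lip)
      also have "\<dots> \<le> g (P x0) + L * (2 * norm w)"
        using Pn L by (intro add_left_mono mult_left_mono) auto
      finally have "g (P y) \<le> x0 \<bullet> e + 2 * L * norm w" using base by simp
      moreover have "(1 + 2 * L) * norm w < (1 + 2 * L) * (\<eta> * d)"
        using w L by (intro mult_strict_left_mono) auto
      moreover have "(\<eta> + 2 * L * \<eta>) * d \<le> 1 / 2 * d"
        using \<eta>(3) d by (intro mult_right_mono) auto
      moreover have "y \<bullet> e = x0 \<bullet> e + d / 2 + w \<bullet> e"
        by (simp add: y inner_add_left ee)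
      ultimately have "g (P y) < y \<bullet> e" using we by (simp add: algebra_simps)
      then show "y \<in> \<Omega>" using epi' [OF yr] by simp
    qed
  qed (use e \<eta> r t in auto)
qed

text \<open>With \<open>d = norm (x - x0)\<close>, the interior ball of radius
  \<open>\<eta> * d\<close> lies within \<open>2 * d\<close> of \<open>x\<close>. It alone
  contributes at least \<open>c * d powr (?n - a)\<close>, whose exponent is negative.\<close>

lemma riesz_potential_tendsto_at_top:
  fixes \<Omega> :: "'a::euclidean_space set"
  assumes C1: "has_C1_boundary \<Omega>" and x0: "x0 \<in> frontier \<Omega>"
    and "open \<Omega>" and a: "real DIM('a) < a"
  shows "filterlim (\<lambda>x. LINT y:\<Omega>|lebesgue. norm (x - y) powr - a) at_top (at x0 within - closure \<Omega>)"
proof -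
  let ?n = "DIM('a)"
  obtain e :: 'a and \<eta> r where e: "norm e = 1" and \<eta>: "0 < \<eta>" "\<eta> \<le> 1 / 2" and r: "0 < r"
    and sub: "\<And>d. 0 < d \<Longrightarrow> d < r \<Longrightarrow> ball (x0 + (d / 2) *\<^sub>R e) (\<eta> * d) \<subseteq> \<Omega>"
    using C1_boundary_interior_balls [OF C1 x0] by metis
  define c where "c = unit_ball_vol ?n * \<eta> ^ ?n * 2 powr - a"
  have c: "0 < c" using \<eta> by (simp add: c_def)
  have le: "c * norm (x - x0) powr (?n - a) \<le> (LINT y:\<Omega>|lebesgue. norm (x - y) powr - a)"
    if x: "x \<notin> closure \<Omega>" "norm (x - x0) < r" for x
  proof -
    define d where "d = norm (x - x0)"
    have d: "0 < d" "d < r" using x x0 by (auto simp: d_def frontier_def)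
    have "unit_ball_vol ?n * (\<eta> * d) ^ ?n * (2 * d) powr - a \<le> (LINT y:\<Omega>|lebesgue. norm (x - y) powr - a)"
    proof (rule riesz_potential_lower_bound)
      show "(\<lambda>y. norm (x - y) powr - a) absolutely_integrable_on \<Omega>"
        using a x assms(3) by (intro riesz_kernel_integrable) auto
      show "ball (x0 + (d / 2) *\<^sub>R e) (\<eta> * d) \<subseteq> \<Omega>" using sub d by blast
      show "x \<notin> \<Omega>" using x closure_subset by blast
      fix y assume y: "y \<in> ball (x0 + (d / 2) *\<^sub>R e) (\<eta> * d)"
      have "norm (x - y) \<le> d + norm (x0 + (d / 2) *\<^sub>R e - y) + d / 2"
        using norm_triangle_ineq [of "x - x0" "x0 - y"]
          norm_triangle_ineq4 [of "x0 + (d / 2) *\<^sub>R e - y" "(d / 2) *\<^sub>R e"] d e by (simp add: d_def)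
      moreover have "\<eta> * d \<le> d / 2" using \<eta> d by (simp add: field_simps)
      ultimately show "norm (x - y) \<le> 2 * d" using y unfolding mem_ball dist_norm by linarith
    qed (use \<eta> d a in auto)
    moreover have "d powr (?n - a) = d ^ ?n * d powr - a"
      using d by (simp add: powr_add [of d "real ?n" "- a", simplified] powr_realpow)
    ultimately show ?thesis
      unfolding d_def [symmetric] using d by (simp add: c_def powr_mult power_mult_distrib mult_ac)
  qed
  have "filterlim (\<lambda>x. norm (x - x0)) (at_right 0) (at x0 within - closure \<Omega>)"
  proof -
    have "((\<lambda>x. norm (x - x0)) \<longlongrightarrow> 0) (at x0 within - closure \<Omega>)"
      by (rule tendsto_norm_zero) (rule LIM_zero, rule tendsto_ident_at)
    moreover have "eventually (\<lambda>x. norm (x - x0) \<in> {0<..} \<and> norm (x - x0) \<noteq> 0) (at x0 within - closure \<Omega>)"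
      unfolding eventually_at_filter by simp
    ultimately show ?thesis unfolding filterlim_at by blast
  qed
  moreover have "filterlim (\<lambda>t. c * t powr (?n - a)) at_top (at_right (0::real))"
  proof -
    have "filterlim (\<lambda>t. exp ((?n - a) * ln t)) at_top (at_right (0::real))"
      using a ln_at_0
      by (intro filterlim_compose [OF exp_at_top]) (simp add: filterlim_tendsto_neg_mult_at_top_iff [OF tendsto_const])
    then have "filterlim (\<lambda>t. c * exp ((?n - a) * ln t)) at_top (at_right (0::real))"
      using c by (intro filterlim_tendsto_pos_mult_at_top [OF tendsto_const])
    moreover have "eventually (\<lambda>t. c * exp ((?n - a) * ln t) = c * t powr (?n - a)) (at_right (0::real))"
      by (auto simp: eventually_at_filter powr_def)
    ultimately show ?thesis by (rule filterlim_mono_eventually [OF _ order_refl order_refl])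
  qed
  ultimately have "filterlim (\<lambda>x. c * norm (x - x0) powr (?n - a)) at_top (at x0 within - closure \<Omega>)"
    by (rule filterlim_compose[rotated])
  moreover have "eventually (\<lambda>x. c * norm (x - x0) powr (?n - a) \<le>
      (LINT y:\<Omega>|lebesgue. norm (x - y) powr - a)) (at x0 within - closure \<Omega>)"
    unfolding eventually_at using le r by (auto simp: dist_norm)
  ultimately show ?thesis by (rule filterlim_at_top_mono)
qed

section \<open>Continuity of \<open>u\<close> in the exterior, at the boundary and in the whole
  space\<close>

theorem proposition5p2:
  fixes s c :: real and \<Omega> :: "(real^'n) set" and u :: "real^'n \<Rightarrow> real"
  assumes "0 < s" and "s < 1"
    and "0 < c"
    and "open \<Omega>" and "connected \<Omega>" and "\<Omega> \<noteq> {}"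
    and "has_C1_boundary \<Omega>"
    and "continuous_on (closure \<Omega>) u"
    and "\<And>x. x \<in> UNIV - closure \<Omega> \<Longrightarrow> neumann_op_vanishes c s \<Omega> u x"
  shows "continuous_on UNIV u"
proof -
  define a where "a = real CARD('n) + 2 * s"
  have a: "real DIM(real^'n) < a" "0 \<le> a" using assms(1) by (auto simp: a_def)
  define K where "K = (\<lambda>x y :: real^'n. norm (x - y) powr - a)"
  have K0: "0 \<le> K x y" for x y by (simp add: K_def)
  define I where "I = (\<lambda>x. LINT y:\<Omega>|lebesgue. K x y)"
  have intK: "K x absolutely_integrable_on \<Omega>" if "x \<notin> closure \<Omega>" for x
    unfolding K_def using a assms(4) that by (intro riesz_kernel_integrable) auto
  have integrand: "neumann_integrand s u x y = u x * K x y - u y * K x y" for x y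
    by (simp add: neumann_integrand_def K_def powr_minus divide_inverse left_diff_distrib flip: a_def)
  \<comment> \<open>\<open>\<Omega>\<close> and \<open>u\<close> may be unbounded; integrability is
    extracted from the absolute convergence contained in the Neumann condition.\<close>
  have intuK: "(\<lambda>y. u y * K x y) absolutely_integrable_on \<Omega>" if "x \<notin> closure \<Omega>" for x
  proof -
    have "(\<lambda>y. u x * K x y - neumann_integrand s u x y) absolutely_integrable_on \<Omega>"
      using assms(9) [of x] that intK [OF that]
      by (intro set_integral_diff set_integrable_mult_right) (auto simp: neumann_op_vanishes_def)
    then show ?thesis by (simp add: integrand)
  qed
  have eq: "(LINT y:\<Omega>|lebesgue. u y * K x y) = u x * I x" if "x \<notin> closure \<Omega>" for x
  proof -
    have "(LINT y:\<Omega>|lebesgue. u x * K x y - u y * K x y) = 0"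
      using assms(3) assms(9) [of x] that
      by (simp add: neumann_op_vanishes_def neumann_op_def integrand [abs_def])
    then show ?thesis
      using intK [OF that] intuK [OF that] by (subst (asm) set_integral_diff) (auto simp: I_def)
  qed
  \<comment> \<open>Any single ball inside \<open>\<Omega>\<close> already carries positive
    weight.\<close>
  have Ipos: "0 < I x" if x: "x \<notin> closure \<Omega>" for x
  proof -
    obtain z \<rho> where z: "0 < \<rho>" "ball z \<rho> \<subseteq> \<Omega>"
      using assms(4,6) open_contains_ball by blast
    have "x \<notin> \<Omega>" using x closure_subset by blast
    have "unit_ball_vol DIM(real^'n) * \<rho> ^ DIM(real^'n) * (norm (x - z) + \<rho>) powr - a \<le> I x"
      unfolding I_def K_def
    proof (rule riesz_potential_lower_bound)
      fix y assume "y \<in> ball z \<rho>"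
      then show "norm (x - y) \<le> norm (x - z) + \<rho>"
        using norm_triangle_ineq [of "x - z" "z - y"] by (simp add: dist_norm)
    qed (use intK [OF x] z a \<open>x \<notin> \<Omega>\<close> in \<open>auto simp: K_def\<close>)
    moreover have "0 < norm (x - z) + \<rho>" using z by (simp add: add_nonneg_pos)
    then have "0 < unit_ball_vol DIM(real^'n) * \<rho> ^ DIM(real^'n) * (norm (x - z) + \<rho>) powr - a"
      using z by (intro mult_pos_pos) auto
    ultimately show ?thesis by linarith
  qed
  have exterior: "isCont u x0" if x0: "x0 \<notin> closure \<Omega>" for x0
  proof -
    have "isCont (\<lambda>x. LINT y:\<Omega>|lebesgue. u y * K x y) x0"
      unfolding K_def using a x0 intuK by (intro riesz_potential_continuous_off_closure) (auto simp: K_def)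
    moreover have "isCont (\<lambda>x. LINT y:\<Omega>|lebesgue. 1 * K x y) x0"
      unfolding K_def using a x0 intK by (intro riesz_potential_continuous_off_closure) (auto simp: K_def)
    ultimately have "isCont (\<lambda>x. (LINT y:\<Omega>|lebesgue. u y * K x y) / I x) x0"
      using Ipos [OF x0] by (intro continuous_intros) (auto simp: I_def)
    moreover have "eventually (\<lambda>x. x \<in> - closure \<Omega>) (nhds x0)"
      using x0 by (intro eventually_nhds_in_open) auto
    \<comment> \<open>The exterior is open, so \<open>u\<close> is the quotient on a whole
      neighbourhood of \<open>x0\<close>.\<close>
    then have "eventually (\<lambda>x. (LINT y:\<Omega>|lebesgue. u y * K x y) / I x = u x) (nhds x0)"
      by eventually_elim (use eq Ipos in force)
    ultimately show ?thesis by (subst (asm) isCont_cong)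
  qed
  have frontier: "continuous (at x0 within - closure \<Omega>) u" if x0: "x0 \<in> frontier \<Omega>" for x0
  \<comment> \<open>A fixed exterior point \<open>x1\<close> is wanted as reference; if there is
    none, the filter is trivial.\<close>
  proof (cases "closure \<Omega> = UNIV")
    case False
    then obtain x1 where x1: "x1 \<notin> closure \<Omega>" by auto
    define J where "J = (\<lambda>x. LINT y:\<Omega>|lebesgue. \<bar>u y - u x0\<bar> * K x y)"
    have intd: "(\<lambda>y. (u y - u x0) * K x y) absolutely_integrable_on \<Omega>" if "x \<notin> closure \<Omega>" for x
      unfolding left_diff_distrib
      using intK [OF that] intuK [OF that] by (intro set_integral_diff set_integrable_mult_right) auto
    have inta: "(\<lambda>y. \<bar>u y - u x0\<bar> * K x y) absolutely_integrable_on \<Omega>" if "x \<notin> closure \<Omega>" for x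
      using set_integrable_abs [OF intd [OF that]] by (simp add: abs_mult K0)
    \<comment> \<open>Subtract \<open>u x0 * I x\<close> from the averaging identity
      \<open>eq\<close> and move the absolute value inside the integral.\<close>
    have le: "\<bar>u x - u x0\<bar> * I x \<le> J x" if x: "x \<notin> closure \<Omega>" for x
    proof -
      have "(u x - u x0) * I x = (LINT y:\<Omega>|lebesgue. (u y - u x0) * K x y)"
        unfolding left_diff_distrib using intK [OF x] intuK [OF x] eq [OF x]
        by (subst set_integral_diff) (auto simp: I_def)
      then have "\<bar>u x - u x0\<bar> * I x = \<bar>LINT y:\<Omega>|lebesgue. (u y - u x0) * K x y\<bar>"
        using Ipos [OF x] by (metis abs_mult abs_of_pos)
      also have "\<dots> \<le> J x"
        using set_integral_norm_bound [OF intd [OF x]] by (simp add: J_def abs_mult K0)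
      finally show ?thesis .
    qed
    have Itop: "filterlim I at_top (at x0 within - closure \<Omega>)"
      unfolding I_def K_def using riesz_potential_tendsto_at_top [OF assms(7) x0 assms(4) a(1)] .
    have x0c: "x0 \<in> closure \<Omega>" using x0 by (auto simp: frontier_def)
    have "eventually (\<lambda>x. dist (u x) (u x0) < \<epsilon>) (at x0 within - closure \<Omega>)" if \<epsilon>: "0 < \<epsilon>" for \<epsilon>
    proof -
      obtain \<delta> where d: "0 < \<delta>"
        and near: "\<And>y. y \<in> closure \<Omega> \<Longrightarrow> dist y x0 < \<delta> \<Longrightarrow> dist (u y) (u x0) < \<epsilon> / 2"
        using assms(8) x0c \<epsilon> unfolding continuous_on_iff by (metis half_gt_zero)
      define M where "M = (2 * (norm (x1 - x0) / \<delta> + 1)) powr a"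
      have M: "0 \<le> M" by (simp add: M_def)
      \<comment> \<open>Split at distance \<open>\<delta>\<close> from \<open>x0\<close>: nearby,
        continuity makes the oscillation of \<open>u\<close> small; farther out, \<open>K x\<close>
        is dominated by \<open>M * K x1\<close>. The second term does not depend on
        \<open>x\<close>.\<close>
      have Jle: "J x \<le> \<epsilon> / 2 * I x + M * J x1" if x: "x \<notin> closure \<Omega>" "dist x x0 < \<delta> / 2" for x
      proof -
        have "J x \<le> (LINT y:\<Omega>|lebesgue. \<epsilon> / 2 * K x y + M * (\<bar>u y - u x0\<bar> * K x1 y))"
          unfolding J_def
        proof (rule set_integral_mono)
          show "(\<lambda>y. \<epsilon> / 2 * K x y + M * (\<bar>u y - u x0\<bar> * K x1 y)) absolutely_integrable_on \<Omega>"
            using intK inta x x1 by (intro set_integral_add set_integrable_mult_right) auto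
          fix y assume y: "y \<in> \<Omega>"
          then have yc: "y \<in> closure \<Omega>" using closure_subset by blast
          show "\<bar>u y - u x0\<bar> * K x y \<le> \<epsilon> / 2 * K x y + M * (\<bar>u y - u x0\<bar> * K x1 y)"
          proof (cases "dist y x0 < \<delta>")
            case True
            then have "\<bar>u y - u x0\<bar> * K x y \<le> \<epsilon> / 2 * K x y"
              using near [OF yc] K0 by (intro mult_right_mono) (auto simp: dist_real_def)
            then show ?thesis using M K0 [of x1 y] by (simp add: add_increasing2)
          next
            case False
            then have "K x y \<le> M * K x1 y"
              unfolding K_def M_def using a d x x1 yc
              by (intro riesz_kernel_le_far) (auto simp: dist_norm norm_minus_commute)
            then have "\<bar>u y - u x0\<bar> * K x y \<le> \<bar>u y - u x0\<bar> * (M * K x1 y)"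
              by (intro mult_left_mono) auto
            then show ?thesis using \<epsilon> K0 [of x y] by (simp add: mult_ac add_increasing)
          qed
        qed (use inta x in auto)
        also have "\<dots> = \<epsilon> / 2 * I x + M * J x1"
          using intK inta x x1 by (subst set_integral_add) (auto simp: I_def J_def)
        finally show ?thesis .
      qed
      have "eventually (\<lambda>x. x \<in> - closure \<Omega> \<and> dist x x0 < \<delta> / 2) (at x0 within - closure \<Omega>)"
        unfolding eventually_at using d by (intro exI [of _ "\<delta> / 2"]) auto
      \<comment> \<open>Beyond this threshold the constant \<open>M * J x1\<close> is less than
        \<open>\<epsilon> / 2 * I x\<close>, and dividing by \<open>I x\<close> gives the
        claim.\<close>
      moreover have "eventually (\<lambda>x. 2 * (M * J x1) / \<epsilon> < I x) (at x0 within - closure \<Omega>)"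
        using Itop by (simp add: filterlim_at_top_dense)
      ultimately show ?thesis
      proof eventually_elim
        case (elim x)
        then have x: "x \<notin> closure \<Omega>" "dist x x0 < \<delta> / 2" by auto
        have "M * J x1 < \<epsilon> / 2 * I x" using elim \<epsilon> by (simp add: field_simps)
        then have "\<bar>u x - u x0\<bar> * I x < \<epsilon> * I x" using le [OF x(1)] Jle [OF x] by simp
        then show ?case using Ipos [OF x(1)] by (simp add: dist_real_def)
      qed
    qed
    then show ?thesis by (simp add: continuous_within tendsto_iff)
  qed simp
  have "continuous (at x0) u" for x0
  proof (cases "x0 \<in> closure \<Omega>")
    case True
    then have inner: "continuous (at x0 within closure \<Omega>) u"
      using assms(8) by (simp add: continuous_on_eq_continuous_within)
    have outer: "continuous (at x0 within - closure \<Omega>) u"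
    proof (cases "x0 \<in> \<Omega>")
      case True
      \<comment> \<open>\<open>\<Omega>\<close> is open and disjoint from the exterior, so its
        points are not limits of exterior points.\<close>
      then have "x0 \<notin> closure (- closure \<Omega>)"
        using open_Int_closure_eq_empty [OF assms(4), of "- closure \<Omega>"] closure_subset by blast
      then have "at x0 within - closure \<Omega> = bot"
        by (metis not_in_closure_trivial_limitI trivial_limit_def)
      then show ?thesis by simp
    qed (use True assms(4) frontier in \<open>auto simp: frontier_def interior_open\<close>)
    show ?thesis
      \<comment> \<open>The two one-sided limits agree with \<open>u x0\<close>, and the two sets
        cover the space.\<close>
      using Lim_Un [of u "u x0" x0 "closure \<Omega>" "- closure \<Omega>"] inner outer by (simp add: continuous_within)
  qed (use exterior in simp)
  then show ?thesis by (simp add: continuous_at_imp_continuous_on)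
qed

end
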